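(* Let $n\ge2$ be an integer and suppose there exists a $2$-$(v,k,\lambda)$ design with $b$ blocks and replication number $r$ satisfying $(n-1)^2=\dfrac{kr}{r-\lambda}$. Then there exists a Latin regular rectangular design with parameters $v^*=vn$, $b^*=bn$, $r^*=r(n-1)$, $k^*=k(n-1)$, $\lambda_1^*=(n-2)r$, $\lambda_2^*=\lambda(n-1)$, $\lambda_3^*=\lambda(n-2)$, $m=v$, $n$.
   Context: A $2$-$(v,k,\lambda)$ design (BIBD) has $v$ treatments, $b$ blocks each of $k<v$ distinct treatments, each treatment in $r$ blocks, and any two distinct treatments together in $\lambda$ blocks. A rectangular design (RD) with parameters $v=mn,b,r,k,\lambda_1,\lambda_2,\lambda_3,m,n$ has its $mn$ treatments arranged in an $m\times n$ array, $b$ blocks of size $k$, replication $r$, and any two distinct treatments occur together in $\lambda_1$ blocks if in the same row, $\lambda_2$ if in the same column, $\lambda_3$ otherwise. It is Latin regular if $\theta_1=\theta_2>0$ and $\theta_3>0$, where $\theta_1=r-\lambda_1+(m-1)(\lambda_2-\lambda_3)$, $\theta_2=r-\lambda_2+(n-1)(\lambda_1-\lambda_3)$, $\theta_3=r-\lambda_1-\lambda_2+\lambda_3$. *)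

theory Defs
  imports Complex_Main "HOL-Library.Multiset"
begin

text \<open>
  Blocks are sets of treatments (so the treatments in a block are distinct), and the blocks
  form a multiset, since a design may contain repeated blocks.
\<close>

definition replication :: "'a set multiset \<Rightarrow> 'a \<Rightarrow> nat" where
  "replication Bs x = size {#B \<in># Bs. x \<in> B#}"

definition concurrence :: "'a set multiset \<Rightarrow> 'a \<Rightarrow> 'a \<Rightarrow> nat" where
  "concurrence Bs x y = size {#B \<in># Bs. x \<in> B \<and> y \<in> B#}"

definition block_design :: "nat \<Rightarrow> nat \<Rightarrow> nat \<Rightarrow> nat \<Rightarrow> 'a set \<Rightarrow> 'a set multiset \<Rightarrow> bool" where
  "block_design v b r k V Bs \<longleftrightarrow>
     finite V \<and> card V = v \<and> size Bs = b \<and>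
     (\<forall>B. B \<in># Bs \<longrightarrow> B \<subseteq> V \<and> card B = k) \<and>
     (\<forall>x\<in>V. replication Bs x = r)"

definition bibd :: "nat \<Rightarrow> nat \<Rightarrow> nat \<Rightarrow> nat \<Rightarrow> nat \<Rightarrow> 'a set \<Rightarrow> 'a set multiset \<Rightarrow> bool" where
  "bibd v b r k l V Bs \<longleftrightarrow>
     block_design v b r k V Bs \<and> k < v \<and>
     (\<forall>x\<in>V. \<forall>y\<in>V. x \<noteq> y \<longrightarrow> concurrence Bs x y = l)"

text \<open>The treatment in row \<open>i < m\<close> and column \<open>j < n\<close> of the array is \<open>arr (i, j)\<close>.\<close>

definition rectangular_design ::
  "nat \<Rightarrow> nat \<Rightarrow> nat \<Rightarrow> nat \<Rightarrow> nat \<Rightarrow> nat \<Rightarrow> nat \<Rightarrow> nat \<Rightarrow> nat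
    \<Rightarrow> 'a set \<Rightarrow> (nat \<times> nat \<Rightarrow> 'a) \<Rightarrow> 'a set multiset \<Rightarrow> bool" where
  "rectangular_design v b r k l1 l2 l3 m n V arr Bs \<longleftrightarrow>
     block_design v b r k V Bs \<and> v = m * n \<and>
     bij_betw arr ({..<m} \<times> {..<n}) V \<and>
     (\<forall>i<m. \<forall>j<n. \<forall>i'<m. \<forall>j'<n. (i, j) \<noteq> (i', j') \<longrightarrow>
        concurrence Bs (arr (i, j)) (arr (i', j')) =
          (if i = i' then l1 else if j = j' then l2 else l3))"

definition theta1 :: "nat \<Rightarrow> nat \<Rightarrow> nat \<Rightarrow> nat \<Rightarrow> nat \<Rightarrow> int" where
  "theta1 r l1 l2 l3 m = int r - int l1 + (int m - 1) * (int l2 - int l3)"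

definition theta2 :: "nat \<Rightarrow> nat \<Rightarrow> nat \<Rightarrow> nat \<Rightarrow> nat \<Rightarrow> int" where
  "theta2 r l1 l2 l3 n = int r - int l2 + (int n - 1) * (int l1 - int l3)"

definition theta3 :: "nat \<Rightarrow> nat \<Rightarrow> nat \<Rightarrow> nat \<Rightarrow> int" where
  "theta3 r l1 l2 l3 = int r - int l1 - int l2 + int l3"

definition latin_regular_rd ::
  "nat \<Rightarrow> nat \<Rightarrow> nat \<Rightarrow> nat \<Rightarrow> nat \<Rightarrow> nat \<Rightarrow> nat \<Rightarrow> nat \<Rightarrow> nat
    \<Rightarrow> 'a set \<Rightarrow> (nat \<times> nat \<Rightarrow> 'a) \<Rightarrow> 'a set multiset \<Rightarrow> bool" where
  "latin_regular_rd v b r k l1 l2 l3 m n V arr Bs \<longleftrightarrow>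
     rectangular_design v b r k l1 l2 l3 m n V arr Bs \<and>
     theta1 r l1 l2 l3 m = theta2 r l1 l2 l3 n \<and>
     theta2 r l1 l2 l3 n > 0 \<and> theta3 r l1 l2 l3 > 0"

end

theory Submission
  imports Defs
begin

text \<open>
  Every block \<open>B\<close> and every column \<open>c\<close> of the \<open>v \<times> n\<close> array yield the new block consisting of the
  rows in \<open>B\<close> with column \<open>c\<close> removed. Two cells in rows \<open>x\<close>, \<open>y\<close> meet in such a block iff \<open>x\<close> and
  \<open>y\<close> both lie in \<open>B\<close> and \<open>c\<close> is neither of their columns, so concurrences multiply. The
  eigenvalues are \<open>\<theta>\<^sub>1 = r + (v - 1) \<lambda> = r k\<close>, \<open>\<theta>\<^sub>2 = (n - 1)\<^sup>2 (r - \<lambda>)\<close> and \<open>\<theta>\<^sub>3 = r - \<lambda>\<close>;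
  the hypothesis on \<open>n\<close> says exactly that \<open>\<theta>\<^sub>1 = \<theta>\<^sub>2\<close>, and it forces \<open>r > \<lambda>\<close>.
\<close>

lemma concurrence_same: "concurrence Bs x x = replication Bs x"
  by (simp add: concurrence_def replication_def)

text \<open>Double counting of the pairs \<open>(y, B)\<close> with \<open>x\<close> and
  \<open>y\<close> both in \<open>B\<close>: first by \<open>y\<close>, then by \<open>B\<close>.
  The term \<open>y = x\<close> is included.\<close>

lemma sum_concurrence:
  assumes "finite V" and "\<And>B. B \<in># Bs \<Longrightarrow> B \<subseteq> V"
  shows "(\<Sum>y\<in>V. concurrence Bs x y) = (\<Sum>B\<in>#Bs. if x \<in> B then card B else 0)"
  using assms(2)
proof (induction Bs)
  case empty
  then show ?case by (simp add: concurrence_def)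
next
  case (add B Bs)
  have "concurrence (add_mset B Bs) x y
      = (if x \<in> B then if y \<in> B then 1 else 0 else 0) + concurrence Bs x y" for y
    by (simp add: concurrence_def)
  moreover have "V \<inter> B = B"
    using add.prems by auto
  then have "(\<Sum>y\<in>V. if y \<in> B then 1 else 0) = card B"
    using assms(1) by (simp flip: sum.inter_restrict)
  ultimately show ?case
    using add by (simp add: sum.distrib)
qed

lemma sum_mset_if_member_const:
  assumes "\<And>B. B \<in># Bs \<Longrightarrow> card B = k"
  shows "(\<Sum>B\<in>#Bs. if x \<in> B then card B else 0) = k * replication Bs x"
  using assms by (induction Bs) (auto simp: replication_def)

text \<open>The classical identity r(k - 1) = \<lambda>(v - 1), with the diagonal term
  \<open>r\<close> kept on the left: this form avoids subtracting from \<open>k\<close> and is the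
  value needed for \<open>theta1\<close>.\<close>

lemma bibd_row_identity:
  assumes "bibd v b r k l V Bs"
  shows "r + (v - 1) * l = k * r"
proof -
  have fin: "finite V" and card: "card V = v" and "k < v"
    and blocks: "\<And>B. B \<in># Bs \<Longrightarrow> B \<subseteq> V" "\<And>B. B \<in># Bs \<Longrightarrow> card B = k"
    and rep: "\<And>x. x \<in> V \<Longrightarrow> replication Bs x = r"
    and conc: "\<And>x y. x \<in> V \<Longrightarrow> y \<in> V \<Longrightarrow> x \<noteq> y \<Longrightarrow> concurrence Bs x y = l"
    using assms by (auto simp: bibd_def block_design_def)
  obtain x where x: "x \<in> V"
    using card \<open>k < v\<close> by fastforce
  have "k * r = (\<Sum>y\<in>V. concurrence Bs x y)"
    using x rep fin blocks by (simp add: sum_concurrence sum_mset_if_member_const)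
  also have "\<dots> = concurrence Bs x x + (\<Sum>y\<in>V - {x}. concurrence Bs x y)"
    using fin x by (rule sum.remove)
  also have "(\<Sum>y\<in>V - {x}. concurrence Bs x y) = (\<Sum>y\<in>V - {x}. l)"
    using x conc by (intro sum.cong) auto
  finally show ?thesis
    using x fin card rep by (simp add: concurrence_same)
qed

text \<open>\<open>g\<close> labels row \<open>i\<close> by a treatment of the given design. The
  preimage is cut down to \<open>{..<v}\<close> because \<open>g\<close> is unconstrained outside
  it.\<close>

definition column_deleted_block :: "nat \<Rightarrow> nat \<Rightarrow> (nat \<Rightarrow> 'a) \<Rightarrow> 'a set \<Rightarrow> nat \<Rightarrow> (nat \<times> nat) set"
  where "column_deleted_block v n g B c = (g -` B \<inter> {..<v}) \<times> ({..<n} - {c})"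

definition column_deleted_blocks ::
    "nat \<Rightarrow> nat \<Rightarrow> (nat \<Rightarrow> 'a) \<Rightarrow> 'a set multiset \<Rightarrow> (nat \<times> nat) set multiset"
  where "column_deleted_blocks v n g Bs =
    (\<Sum>c<n. image_mset (\<lambda>B. column_deleted_block v n g B c) Bs)"

lemma set_mset_column_deleted_blocks:
  "C \<in># column_deleted_blocks v n g Bs \<longleftrightarrow>
     (\<exists>c<n. \<exists>B. B \<in># Bs \<and> C = column_deleted_block v n g B c)"
  by (auto simp: column_deleted_blocks_def set_mset_sum)

lemma size_column_deleted_blocks: "size (column_deleted_blocks v n g Bs) = size Bs * n"
  by (simp add: column_deleted_blocks_def size_multiset_sum)

lemma filter_mset_sum:
  "filter_mset P (\<Sum>i\<in>I. M i) = (\<Sum>i\<in>I. filter_mset P (M i))"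
  by (induction I rule: infinite_finite_induct) auto

lemma card_column_deleted_block:
  assumes g: "bij_betw g {..<v} V" and "B \<subseteq> V" and "c < n"
  shows "card (column_deleted_block v n g B c) = card B * (n - 1)"
proof -
  have "g ` (g -` B \<inter> {..<v}) = B" and "inj_on g (g -` B \<inter> {..<v})"
    using assms by (auto simp: bij_betw_def inj_on_def)
  then have "card (g -` B \<inter> {..<v}) = card B"
    by (metis card_image)
  then show ?thesis
    using \<open>c < n\<close> by (simp add: column_deleted_block_def card_cartesian_product)
qed

text \<open>The two cells may coincide or share a row or a column, so this one product formula
  yields the replication number and all three concurrences.\<close>

lemma concurrence_column_deleted_blocks:
  assumes "i < v" "i' < v" "j < n" "j' < n"
  shows "concurrence (column_deleted_blocks v n g Bs) (i, j) (i', j')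
    = concurrence Bs (g i) (g i') * card ({..<n} - {j, j'})"
proof -
  have "size {#C \<in># image_mset (\<lambda>B. column_deleted_block v n g B c) Bs. (i, j) \<in> C \<and> (i', j') \<in> C#}
      = (if c \<in> {j, j'} then 0 else concurrence Bs (g i) (g i'))" for c
    using assms
    by (auto simp: filter_mset_image_mset column_deleted_block_def concurrence_def
        intro!: arg_cong[where f = size] filter_mset_cong)
  then have "concurrence (column_deleted_blocks v n g Bs) (i, j) (i', j')
      = (\<Sum>c<n. if c \<in> {j, j'} then 0 else concurrence Bs (g i) (g i'))"
    \<comment> \<open>Only this instance is unfolded, so that the concurrences in \<open>Bs\<close>
      stay folded.\<close>
    unfolding concurrence_def[of "column_deleted_blocks v n g Bs"]
    unfolding column_deleted_blocks_def by (simp only: filter_mset_sum size_multiset_sum)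
  also have "\<dots> = (\<Sum>c\<in>{..<n} - {j, j'}. concurrence Bs (g i) (g i'))"
    by (intro sum.mono_neutral_cong_right) auto
  finally show ?thesis by simp
qed

lemma rectangular_design_column_deleted_blocks:
  assumes "bibd v b r k l V Bs" and g: "bij_betw g {..<v} V"
  shows "rectangular_design (v * n) (b * n) (r * (n - 1)) (k * (n - 1))
      ((n - 2) * r) (l * (n - 1)) (l * (n - 2)) v n
      ({..<v} \<times> {..<n}) id (column_deleted_blocks v n g Bs)"
proof -
  have size: "size Bs = b"
    and blocks: "\<And>B. B \<in># Bs \<Longrightarrow> B \<subseteq> V" "\<And>B. B \<in># Bs \<Longrightarrow> card B = k"
    and rep: "\<And>x. x \<in> V \<Longrightarrow> replication Bs x = r"
    and conc: "\<And>x y. x \<in> V \<Longrightarrow> y \<in> V \<Longrightarrow> x \<noteq> y \<Longrightarrow> concurrence Bs x y = l"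
    using assms by (auto simp: bibd_def block_design_def)
  have gV: "g i \<in> V" if "i < v" for i
    using g that by (auto simp: bij_betw_def)
  have g_eq: "g i = g i' \<longleftrightarrow> i = i'" if "i < v" "i' < v" for i i'
    using g that by (auto simp: bij_betw_def inj_on_def)
  let ?Cs = "column_deleted_blocks v n g Bs"
  have "C \<subseteq> {..<v} \<times> {..<n} \<and> card C = k * (n - 1)" if C: "C \<in># ?Cs" for C
  proof -
    obtain c B where "c < n" "B \<in># Bs" "C = column_deleted_block v n g B c"
      using C by (auto simp: set_mset_column_deleted_blocks)
    moreover from this have "card C = k * (n - 1)"
      using blocks card_column_deleted_block[OF g] by simp
    ultimately show ?thesis
      by (auto simp: column_deleted_block_def)
  qed
  \<comment> \<open>Replication is the concurrence of a cell with itself, which excludes just the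
    one column \<open>j\<close>.\<close>
  moreover have "replication ?Cs (i, j) = r * (n - 1)" if "i < v" "j < n" for i j
    using that rep gV by (simp add: concurrence_column_deleted_blocks flip: concurrence_same)
  moreover have "concurrence ?Cs (i, j) (i', j') =
      (if i = i' then (n - 2) * r else if j = j' then l * (n - 1) else l * (n - 2))"
    if "i < v" "j < n" "i' < v" "j' < n" "(i, j) \<noteq> (i', j')" for i j i' j'
  proof -
    \<comment> \<open>Two distinct columns below \<open>n\<close> force \<open>n\<close> \<ge> 2, so
      \<open>n - 2\<close> is not truncated where it occurs.\<close>
    have "card ({..<n} - {j, j'}) = (if j = j' then n - 1 else n - 2)"
      using that by (simp add: card_Diff_subset numeral_2_eq_2)
    then show ?thesis
      using that rep conc gV g_eq
      by (auto simp: concurrence_column_deleted_blocks concurrence_same)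
  qed
  ultimately show ?thesis
    using size
    by (auto simp: rectangular_design_def block_design_def size_column_deleted_blocks)
qed

theorem theorem5:
  fixes n v b r k l :: nat and V :: "'a set" and Bs :: "'a set multiset"
  assumes "n \<ge> 2"
    and "bibd v b r k l V Bs"
    and "(real n - 1)\<^sup>2 = real k * real r / (real r - real l)"
  shows "\<exists>(W :: (nat \<times> nat) set) arr Cs.
    latin_regular_rd (v * n) (b * n) (r * (n - 1)) (k * (n - 1))
      ((n - 2) * r) (l * (n - 1)) (l * (n - 2)) v n W arr Cs"
proof -
  have "finite V" "card V = v" "k < v"
    using assms(2) by (auto simp: bibd_def block_design_def)
  then obtain g where g: "bij_betw g {..<v} V"
    using ex_bij_betw_nat_finite by (metis atLeast0LessThan)
  \<comment> \<open>Since \<open>n\<close> \<ge> 2, the square is positive. Division by zero gives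
    0, so positivity rules out \<open>r = l\<close>; the numerator is nonnegative, so it also rules
    out \<open>r < l\<close>.\<close>
  have "real k * real r / (real r - real l) > 0"
    using assms(1) by (simp flip: assms(3))
  then have rl: "real r > real l"
    by (auto simp: zero_less_divide_iff mult_less_0_iff)
  then have "(real n - 1)\<^sup>2 * (real r - real l) = real k * real r"
    using assms(3) by simp
  then have "real_of_int ((int n - 1)\<^sup>2 * (int r - int l)) = real_of_int (int k * int r)"
    by simp
  then have kr: "(int n - 1)\<^sup>2 * (int r - int l) = int k * int r"
    by (simp only: of_int_eq_iff)
  have n: "int (n - 1) = int n - 1" "int (n - 2) = int n - 2"
    using assms(1) by auto
  have "int (r + (v - 1) * l) = int (k * r)"
    by (simp only: bibd_row_identity[OF assms(2)])
  then have row: "int r + (int v - 1) * int l = int k * int r"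
    using \<open>k < v\<close> by (simp add: of_nat_diff)
  have t1: "theta1 (r * (n - 1)) ((n - 2) * r) (l * (n - 1)) (l * (n - 2)) v = int k * int r"
    \<comment> \<open>Rewriting \<open>k * r\<close> backwards by \<open>row\<close> leaves a
      polynomial identity: the coefficients of \<open>r\<close> and of \<open>(v - 1) * l\<close>
      both collapse to (n - 1) - (n - 2) = 1.\<close>
    unfolding theta1_def of_nat_mult n row[symmetric] by (simp add: algebra_simps)
  have t2: "theta2 (r * (n - 1)) ((n - 2) * r) (l * (n - 1)) (l * (n - 2)) n
      = (int n - 1)\<^sup>2 * (int r - int l)"
    unfolding theta2_def of_nat_mult n by (simp add: algebra_simps power2_eq_square)
  have t3: "theta3 (r * (n - 1)) ((n - 2) * r) (l * (n - 1)) (l * (n - 2)) = int r - int l"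
    unfolding theta3_def of_nat_mult n by (simp add: algebra_simps)
  have "(int n - 1)\<^sup>2 * (int r - int l) > 0"
    using rl assms(1) by simp
  then have "latin_regular_rd (v * n) (b * n) (r * (n - 1)) (k * (n - 1))
      ((n - 2) * r) (l * (n - 1)) (l * (n - 2)) v n
      ({..<v} \<times> {..<n}) id (column_deleted_blocks v n g Bs)"
    unfolding latin_regular_rd_def t1 t2 t3
    using rectangular_design_column_deleted_blocks[OF assms(2) g] kr rl by auto
  then show ?thesis by blast
qed

end
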